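(* The unrestricted Kruskal--Wallis test is detection incoherent. That is, let $K\ge 2$, let $\lambda_1,\dots,\lambda_K>0$ with $\sum_k\lambda_k=1$ be the limiting group proportions, let $\mathcal P$ be the set of all $K$-tuples $(F_1,\dots,F_K)$ of probability distributions on $\mathbb R$, let $\mathcal H_0=\{(F_1,\dots,F_K)\in\mathcal P: F_1=\cdots=F_K\}$, and let $\mathcal D_0=\{(F_1,\dots,F_K)\in\mathcal P: (p_1,\dots,p_K)=(1/2,\dots,1/2)\}$ be the detection-null set of the test. Then the blind spot $$\mathcal S_{\mathcal P}=\mathcal D_0\setminus\mathcal H_0$$ is non-empty.
   Context: For a tuple $(F_1,\dots,F_K)$ put $p_k=P(X<X_k)+\tfrac12P(X=X_k)$, where $X_k\sim F_k$ and $X$ is independent of $X_k$ and distributed according to the pooled distribution $\sum_{j=1}^K\lambda_jF_j$, with $\lambda_j=\lim n_j/n$. The Kruskal--Wallis test is calibrated under the null $\mathcal H_0$ ($F_1=\cdots=F_K$). Its detector is the vector $(\bar R_1/(n+1),\dots,\bar R_K/(n+1))$ of normalized mean (mid-)ranks of the groups in the pooled sample. The detector converges in probability to the detection functional $\theta(F_1,\dots,F_K)=(p_1,\dots,p_K)$. On $\mathcal H_0$ the functional has the constant value $\theta^*=(1/2,\dots,1/2)$. The detection-null set is $\mathcal D_0=\{\theta=\theta^*\}$ and the blind spot is $\mathcal S_{\mathcal P}=\mathcal D_0\setminus\mathcal H_0$. An unrestricted test (one defined over all of $\mathcal P$) is detection coherent if $\mathcal S_{\mathcal P}=\emptyset$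 and detection incoherent otherwise. *)

theory Defs
  imports "HOL-Probability.Probability"
begin

text \<open>
  \<open>K\<close>-tuples are extensional functions on \<open>{1..K}\<close> (value \<open>undefined\<close> elsewhere), so that
  equality of tuples is equality of functions.  A probability distribution on the reals is a
  measure satisfying the library predicate \<^const>\<open>real_distribution\<close>.
\<close>

definition detection_null_set :: "'p set \<Rightarrow> ('p \<Rightarrow> 't) \<Rightarrow> 't \<Rightarrow> 'p set" where
  "detection_null_set P \<theta> \<theta>\<^sub>0 = {F \<in> P. \<theta> F = \<theta>\<^sub>0}"

definition blind_spot :: "'p set \<Rightarrow> 'p set \<Rightarrow> ('p \<Rightarrow> 't) \<Rightarrow> 't \<Rightarrow> 'p set" where
  "blind_spot P H0 \<theta> \<theta>\<^sub>0 = detection_null_set P \<theta> \<theta>\<^sub>0 - H0"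

definition detection_coherent :: "'p set \<Rightarrow> 'p set \<Rightarrow> ('p \<Rightarrow> 't) \<Rightarrow> 't \<Rightarrow> bool" where
  "detection_coherent P H0 \<theta> \<theta>\<^sub>0 \<longleftrightarrow> blind_spot P H0 \<theta> \<theta>\<^sub>0 = {}"

definition kw_model :: "nat \<Rightarrow> (nat \<Rightarrow> real measure) set" where
  "kw_model K = (\<Pi>\<^sub>E k\<in>{1..K}. {M. real_distribution M})"

definition kw_null :: "nat \<Rightarrow> (nat \<Rightarrow> real measure) set" where
  "kw_null K = {F \<in> kw_model K. \<forall>i\<in>{1..K}. \<forall>j\<in>{1..K}. F i = F j}"

definition pooled :: "nat \<Rightarrow> (nat \<Rightarrow> real) \<Rightarrow> (nat \<Rightarrow> real measure) \<Rightarrow> real measure" where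
  "pooled K w F =
     measure_of UNIV (sets borel) (\<lambda>A. \<Sum>j\<in>{1..K}. ennreal (w j) * emeasure (F j) A)"

text \<open>Independence of \<open>X\<^sub>k\<close> and the pooled variable is expressed by the product measure.\<close>

definition kw_p :: "nat \<Rightarrow> (nat \<Rightarrow> real) \<Rightarrow> (nat \<Rightarrow> real measure) \<Rightarrow> nat \<Rightarrow> real" where
  "kw_p K w F k =
     measure (F k \<Otimes>\<^sub>M pooled K w F) {(x\<^sub>k, x). x < x\<^sub>k}
     + 1 / 2 * measure (F k \<Otimes>\<^sub>M pooled K w F) {(x\<^sub>k, x). x = x\<^sub>k}"

definition kw_theta :: "nat \<Rightarrow> (nat \<Rightarrow> real) \<Rightarrow> (nat \<Rightarrow> real measure) \<Rightarrow> (nat \<Rightarrow> real)" where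
  "kw_theta K w F = (\<lambda>k\<in>{1..K}. kw_p K w F k)"

definition kw_theta_null :: "nat \<Rightarrow> (nat \<Rightarrow> real)" where
  "kw_theta_null K = (\<lambda>k\<in>{1..K}. 1 / 2)"

text \<open>Sanity checks: \<^const>\<open>pooled\<close> is the mixture distribution (the set function passed to
  \<^const>\<open>measure_of\<close> is a measure), and \<^const>\<open>kw_theta\<close> is constant on the null.\<close>

lemma sets_pooled [simp, measurable_cong]: "sets (pooled K w F) = sets borel"
  and space_pooled [simp]: "space (pooled K w F) = UNIV"
  unfolding pooled_def using sets.sigma_algebra_axioms[of "borel :: real measure"]
  by (simp_all add: sigma_algebra.sigma_sets_eq space_measure_of_conv)

lemma emeasure_pooled:
  assumes F: "F \<in> kw_model K" and A: "A \<in> sets borel"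
  shows "emeasure (pooled K w F) A = (\<Sum>j\<in>{1..K}. ennreal (w j) * emeasure (F j) A)"
  unfolding pooled_def
proof (rule emeasure_measure_of_sigma)
  have s: "sets (F j) = sets borel" if "j \<in> {1..K}" for j
    using F that by (auto simp: kw_model_def PiE_iff real_distribution_def
        real_distribution_axioms_def)
  show "sigma_algebra UNIV (sets (borel :: real measure))"
    using sets.sigma_algebra_axioms[of "borel :: real measure"] by simp
  show "positive (sets borel) (\<lambda>A. \<Sum>j\<in>{1..K}. ennreal (w j) * emeasure (F j) A)"
    by (simp add: positive_def)
  show "countably_additive (sets borel) (\<lambda>A. \<Sum>j\<in>{1..K}. ennreal (w j) * emeasure (F j) A)"
  proof (rule countably_additiveI)
    fix B :: "nat \<Rightarrow> real set"
    assume B: "range B \<subseteq> sets borel" "disjoint_family B"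
    have "(\<Sum>i. \<Sum>j\<in>{1..K}. ennreal (w j) * emeasure (F j) (B i))
        = (\<Sum>j\<in>{1..K}. \<Sum>i. ennreal (w j) * emeasure (F j) (B i))"
      by (rule suminf_sum) simp
    also have "\<dots> = (\<Sum>j\<in>{1..K}. ennreal (w j) * emeasure (F j) (\<Union>i. B i))"
      using B s by (intro sum.cong refl) (simp add: suminf_emeasure)
    finally show "(\<Sum>i. \<Sum>j\<in>{1..K}. ennreal (w j) * emeasure (F j) (B i))
        = (\<Sum>j\<in>{1..K}. ennreal (w j) * emeasure (F j) (\<Union>i. B i))" .
  qed
qed (rule A)

lemma kw_theta_on_null:
  assumes F: "F \<in> kw_null K"
    and w: "\<And>k. k \<in> {1..K} \<Longrightarrow> w k > 0" "(\<Sum>k\<in>{1..K}. w k) = 1"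
  shows "kw_theta K w F = kw_theta_null K"
proof -
  have "kw_p K w F k = 1 / 2" if k: "k \<in> {1..K}" for k
  proof -
    have Fm: "F \<in> kw_model K" and eq: "\<And>j. j \<in> {1..K} \<Longrightarrow> F j = F k"
      using F k unfolding kw_null_def by blast+
    interpret M: real_distribution "F k"
      using Fm k by (auto simp: kw_model_def PiE_iff)
    have pool: "pooled K w F = F k"
    proof (rule measure_eqI)
      fix A assume "A \<in> sets (pooled K w F)"
      then have "emeasure (pooled K w F) A = (\<Sum>j\<in>{1..K}. ennreal (w j) * emeasure (F j) A)"
        using Fm by (simp add: emeasure_pooled)
      also have "\<dots> = (\<Sum>j\<in>{1..K}. ennreal (w j)) * emeasure (F k) A"
        unfolding sum_distrib_right by (intro sum.cong refl) (simp only: eq)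
      also have "(\<Sum>j\<in>{1..K}. ennreal (w j)) = ennreal (\<Sum>j\<in>{1..K}. w j)"
        using w(1) by (intro sum_ennreal) (auto intro: less_imp_le)
      finally show "emeasure (pooled K w F) A = emeasure (F k) A"
        by (simp only: w(2) ennreal_1 mult_1_left)
    qed simp
    let ?P = "F k \<Otimes>\<^sub>M F k"
    interpret P: pair_prob_space "F k" "F k" ..
    have S: "sets ?P = sets borel"
      using sets_pair_measure_cong[of "F k" borel "F k" borel]
      by (metis M.events_eq_borel borel_prod)
    have m: "{(x, y). y < x} \<in> sets ?P" (is "?L \<in> _")
      "{(x, y). x < y} \<in> sets ?P" (is "?U \<in> _")
      "{(x, y). y = x} \<in> sets ?P" (is "?D \<in> _")
      unfolding S split_beta
      by (intro borel_open open_Collect_less borel_closed closed_Collect_eq continuous_intros)+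
    have sp: "space ?P = UNIV"
      by (simp add: space_pair_measure)
    have "measure ?P ?L = measure (distr ?P ?P (\<lambda>(x, y). (y, x))) ?L"
      using P.distr_pair_swap by simp
    also have "\<dots> = measure ?P ((\<lambda>(x, y). (y, x)) -` ?L \<inter> space ?P)"
      by (rule measure_distr) (use m in simp_all)
    also have "(\<lambda>(x, y). (y, x)) -` ?L \<inter> space ?P = ?U"
      unfolding sp by auto
    finally have sw: "measure ?P ?L = measure ?P ?U" .
    have "measure ?P ((?L \<union> ?U) \<union> ?D) = measure ?P (?L \<union> ?U) + measure ?P ?D"
      using m by (intro P.finite_measure_Union) auto
    also have "measure ?P (?L \<union> ?U) = measure ?P ?L + measure ?P ?U"
      using m by (intro P.finite_measure_Union) auto
    finally have tot: "measure ?P ((?L \<union> ?U) \<union> ?D) = measure ?P ?L + measure ?P ?U + measure ?P ?D" .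
    have "(?L \<union> ?U) \<union> ?D = space ?P"
      unfolding sp by (auto simp: set_eq_iff)
    then have "measure ?P ((?L \<union> ?U) \<union> ?D) = 1"
      using P.prob_space by (simp only:)
    then show ?thesis
      using sw tot by (simp add: kw_p_def pool)
  qed
  then show ?thesis
    by (auto simp: kw_theta_def kw_theta_null_def)
qed

end

(* Any two independent real random variables with distributions symmetric about 0 satisfy
   P(Y < X) + P(Y = X)/2 = 1/2, because (X, Y) and (-X, -Y) have the same law.  Mixtures of
   symmetric distributions are symmetric, so every tuple of symmetric distributions is
   detection-null; a point mass at 0 next to uniform distributions on {-1, 1} is such a tuple
   outside the null hypothesis. *)
theory Submission
  imports Defs
begin

text \<open>Joint negation preserves the product law and exchanges the two open half-planes off the
  diagonal, so these have equal mass. With the diagonal they partition the plane, hence one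
  half-plane plus half the diagonal carries mass 1/2.\<close>

lemma mid_rank_probability_symmetric:
  assumes "real_distribution M" "real_distribution N"
    and symM: "distr M borel uminus = M" and symN: "distr N borel uminus = N"
  shows "measure (M \<Otimes>\<^sub>M N) {(x, y). y < x} + 1 / 2 * measure (M \<Otimes>\<^sub>M N) {(x, y). y = x} = 1 / 2"
proof -
  interpret M: real_distribution M by fact
  interpret N: real_distribution N by fact
  interpret P: pair_prob_space M N ..
  let ?P = "M \<Otimes>\<^sub>M N" and ?neg = "\<lambda>(x, y). (- x, - y) :: real \<times> real"
  have S: "sets ?P = sets borel"
    using sets_pair_measure_cong[of M borel N borel]
    by (metis M.events_eq_borel N.events_eq_borel borel_prod)
  have m: "{(x, y). y < x} \<in> sets ?P" (is "?L \<in> _")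
    "{(x, y). x < y} \<in> sets ?P" (is "?U \<in> _")
    "{(x, y). y = x} \<in> sets ?P" (is "?D \<in> _")
    unfolding S split_beta
    by (intro borel_open open_Collect_less borel_closed closed_Collect_eq continuous_intros)+
  have sp: "space ?P = UNIV"
    by (simp add: space_pair_measure)
  have mneg: "?neg \<in> measurable ?P (borel \<Otimes>\<^sub>M borel)"
    by measurable
  have "?P = distr M borel uminus \<Otimes>\<^sub>M distr N borel uminus"
    by (simp only: symM symN)
  also have "\<dots> = distr ?P (borel \<Otimes>\<^sub>M borel) ?neg"
    \<comment> \<open>The rule asks for sigma-finiteness of the second pushforward, which by
      \<open>symN\<close> is \<open>N\<close> itself.\<close>
    by (rule pair_measure_distr) (simp_all add: symN N.sigma_finite_measure_axioms)
  finally have "measure ?P ?L = measure (distr ?P (borel \<Otimes>\<^sub>M borel) ?neg) ?L"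
    by simp
  also have "\<dots> = measure ?P (?neg -` ?L \<inter> space ?P)"
    by (rule measure_distr[OF mneg]) (use m S in \<open>simp add: borel_prod\<close>)
  also have "?neg -` ?L \<inter> space ?P = ?U"
    unfolding sp by auto
  finally have sw: "measure ?P ?L = measure ?P ?U" .
  have "measure ?P ((?L \<union> ?U) \<union> ?D) = measure ?P (?L \<union> ?U) + measure ?P ?D"
    using m by (intro P.finite_measure_Union) auto
  also have "measure ?P (?L \<union> ?U) = measure ?P ?L + measure ?P ?U"
    using m by (intro P.finite_measure_Union) auto
  finally have tot: "measure ?P ((?L \<union> ?U) \<union> ?D) = measure ?P ?L + measure ?P ?U + measure ?P ?D" .
  have "(?L \<union> ?U) \<union> ?D = space ?P"
    unfolding sp by (auto simp: set_eq_iff)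
  then have "measure ?P ((?L \<union> ?U) \<union> ?D) = 1"
    using P.prob_space by (simp only:)
  then show ?thesis
    using sw tot by simp
qed

lemma real_distribution_pooled:
  assumes F: "F \<in> kw_model K"
    and w: "\<And>k. k \<in> {1..K} \<Longrightarrow> w k \<ge> 0" "(\<Sum>k\<in>{1..K}. w k) = 1"
  shows "real_distribution (pooled K w F)"
proof -
  have one: "emeasure (F j) UNIV = 1" if "j \<in> {1..K}" for j
  proof -
    interpret real_distribution "F j"
      using F that by (auto simp: kw_model_def PiE_iff)
    show ?thesis
      using emeasure_space_1 by simp
  qed
  have "emeasure (pooled K w F) UNIV = (\<Sum>j\<in>{1..K}. ennreal (w j))"
    using F by (simp add: emeasure_pooled one del: One_nat_def)
  also have "\<dots> = 1"
    \<comment> \<open>The sign condition on the weights enters here: \<open>ennreal\<close> maps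
      negative reals to 0, so it commutes with sums only for nonnegative terms.\<close>
    using w by (subst sum_ennreal) auto
  finally show ?thesis
    by (auto simp: real_distribution_def real_distribution_axioms_def intro!: prob_spaceI)
qed

text \<open>Reflection acts on a mixture component by component and leaves the weights
  alone.\<close>

lemma pooled_symmetric:
  assumes F: "F \<in> kw_model K"
    and sym: "\<And>k. k \<in> {1..K} \<Longrightarrow> distr (F k) borel uminus = F k"
  shows "distr (pooled K w F) borel uminus = pooled K w F"
proof (rule measure_eqI)
  fix A assume "A \<in> sets (distr (pooled K w F) borel uminus)"
  then have A: "A \<in> sets borel" by simp
  have A': "uminus -` A \<in> sets (borel :: real measure)"
    using measurable_sets[OF borel_measurable_uminus[OF measurable_ident] A] by simp
  have "emeasure (F j) (uminus -` A) = emeasure (F j) A" if j: "j \<in> {1..K}" for j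
  proof -
    interpret real_distribution "F j"
      using F j by (auto simp: kw_model_def PiE_iff)
    have "emeasure (distr (F j) borel uminus) A = emeasure (F j) (uminus -` A)"
      using A by (subst emeasure_distr) auto
    then show ?thesis
      by (simp only: sym[OF j])
  qed
  then show "emeasure (distr (pooled K w F) borel uminus) A = emeasure (pooled K w F) A"
    using A A' by (simp add: emeasure_distr emeasure_pooled[OF F])
qed simp

text \<open>Supplies detection-null tuples whose components need only share the centre of symmetry 0
  and may differ in shape or spread.\<close>

lemma kw_theta_symmetric:
  assumes F: "F \<in> kw_model K"
    and sym: "\<And>k. k \<in> {1..K} \<Longrightarrow> distr (F k) borel uminus = F k"
    and w: "\<And>k. k \<in> {1..K} \<Longrightarrow> w k \<ge> 0" "(\<Sum>k\<in>{1..K}. w k) = 1"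
  shows "kw_theta K w F = kw_theta_null K"
proof -
  have "kw_p K w F k = 1 / 2" if k: "k \<in> {1..K}" for k
    unfolding kw_p_def
  proof (rule mid_rank_probability_symmetric)
    show "real_distribution (F k)"
      using F k by (auto simp: kw_model_def PiE_iff)
    show "real_distribution (pooled K w F)"
      using F w by (rule real_distribution_pooled)
    show "distr (F k) borel uminus = F k"
      using k by (rule sym)
    show "distr (pooled K w F) borel uminus = pooled K w F"
      using F sym by (rule pooled_symmetric)
  qed
  then show ?thesis
    by (auto simp: kw_theta_def kw_theta_null_def)
qed

theorem mainTheorem2:
  fixes K :: nat and w :: "nat \<Rightarrow> real"
  assumes "K \<ge> 2"
    and "\<And>k. k \<in> {1..K} \<Longrightarrow> w k > 0"
    and "(\<Sum>k\<in>{1..K}. w k) = 1"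
  shows "\<not> detection_coherent (kw_model K) (kw_null K) (kw_theta K w) (kw_theta_null K)"
proof -
  define p :: "real pmf" where "p = pmf_of_set {-1, 1}"
  \<comment> \<open>The Rademacher law, pushed from the discrete sigma-algebra of
    \<open>measure_pmf\<close> to the Borel one that \<open>real_distribution\<close>
    demands.\<close>
  define G :: "real measure" where "G = distr (measure_pmf p) borel (\<lambda>x. x)"
  define D :: "real measure" where "D = return borel 0"
  define F where "F = (\<lambda>k\<in>{1..K}. if k = 1 then D else G)"
  have "real_distribution D"
    by (auto simp: D_def real_distribution_def real_distribution_axioms_def prob_space_return)
  moreover have "real_distribution G"
    by (auto simp: G_def real_distribution_def real_distribution_axioms_def
        intro!: measure_pmf.prob_space_distr)
  ultimately have model: "F \<in> kw_model K"
    by (auto simp: F_def kw_model_def)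
  have "map_pmf uminus p = p"
    unfolding p_def by (subst map_pmf_of_set_inj) (auto simp: insert_commute)
  \<comment> \<open>The invariance of \<open>p\<close> under negation is carried over to
    \<open>G\<close> by regrouping the composed pushforwards.\<close>
  then have "G = distr (distr (measure_pmf p) (count_space UNIV) uminus) borel (\<lambda>x. x)"
    unfolding G_def by (simp only: map_pmf_rep_eq[symmetric])
  then have "distr (measure_pmf p) borel uminus = G"
    by (simp add: distr_distr comp_def)
  then have symG: "distr G borel uminus = G"
    by (simp add: G_def distr_distr comp_def)
  have symD: "distr D borel uminus = D"
    by (simp add: D_def distr_return)
  have theta: "kw_theta K w F = kw_theta_null K"
    using model assms(2,3) by (intro kw_theta_symmetric)
      (auto simp: F_def symG symD intro: less_imp_le)
  \<comment> \<open>The atom at 0 separates the two laws; since \<open>K \<ge> 2\<close>, both occur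
    in \<open>F\<close>.\<close>
  have "emeasure D {0} = 1"
    by (simp add: D_def)
  moreover have "emeasure G {0} = 0"
    by (simp add: G_def emeasure_distr p_def emeasure_pmf_single)
  ultimately have "D \<noteq> G"
    by auto
  then have "F 1 \<noteq> F 2"
    using assms(1) by (simp add: F_def)
  moreover have "1 \<in> {1..K}" "2 \<in> {1..K}"
    using assms(1) by auto
  ultimately have "F \<notin> kw_null K"
    unfolding kw_null_def by blast
  then show ?thesis
    using model theta
    by (auto simp: detection_coherent_def blind_spot_def detection_null_set_def)
qed

end
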